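(* Let $\mathcal{T}=(T_1,T_2,T_3)$ be a solution to Nahm's equations on a nonempty, connected, open interval, with values in $\mathfrak{su}(n)^{\oplus3}$. If $\mathcal{T}$ is axially symmetric around the third axis and the corresponding function $A\mapsto U_A$ can be chosen to be continuously differentiable at the identity of $\mathrm{SO}(3)$, then there exists $Y\in\mathfrak{su}(n)$ such that (at every point of the domain) $$T_1=[T_2,Y],\qquad T_2=[Y,T_1],\qquad 0=[Y,T_3].\qquad( * )$$ Conversely, if $( * )$ is satisfied for some $Y\in\mathfrak{su}(n)$, then $\mathcal{T}$ is axially symmetric around the third axis. More generally, $\mathcal{T}$ is axially symmetric around some axis if there exists $B\in\mathrm{SO}(3)$ such that ${}^B\mathcal{T}$ satisfies $( * )$ for some $Y\in\mathfrak{su}(n)$.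
   Context: Nahm's equations are $\dot T_1=[T_2,T_3]$, $\dot T_2=[T_3,T_1]$, $\dot T_3=[T_1,T_2]$. For $A\in\mathrm{SO}(3)$ and $U\in\mathrm{SU}(n)$ set ${}^A\mathcal{T}=({}^AT_1,{}^AT_2,{}^AT_3)$ with ${}^AT_i:=\sum_{j=1}^3A_{ij}T_j$, and ${}_U\mathcal{T}$ with ${}_UT_i:=UT_iU^{-1}$. A solution $\mathcal{T}$ is $A$-equivariant if there exists $U_A\in\mathrm{SU}(n)$ (independent of $t$) with ${}^A\mathcal{T}={}_{U_A^{-1}}\mathcal{T}$; for $H\subseteq\mathrm{SO}(3)$ it is $H$-equivariant if it is $A$-equivariant for all $A\in H$, and then one gets a (not necessarily unique) function $H\to\mathrm{SU}(n)$, $A\mapsto U_A$. It is axially symmetric (around an axis) if it is $H$-equivariant for $H\simeq\mathrm{SO}(2)$ the group of rotations around that axis. Axial symmetry around the third axis means $H=\{A(\theta):\theta\in[0,2\pi)\}$ with $$A(\theta)=\begin{pmatrix}\cos\theta&-\sin\theta&0\\ \sin\theta&\cos\theta&0\\0&0&1\end{pmatrix},$$ which parametrizes $H$ by $\theta$; differentiability of $A\mapsto U_A$ is with respect to this subgroup. *)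

theory Defs
  imports "HOL-Analysis.Analysis"
begin

definition conj_transpose :: "complex^'n^'m \<Rightarrow> complex^'m^'n" where
  "conj_transpose M = (\<chi> i j. cnj (M $ j $ i))"

definition SU :: "(complex^'n^'n) set" where
  "SU = {U. conj_transpose U ** U = mat 1 \<and> U ** conj_transpose U = mat 1 \<and> det U = 1}"

definition su :: "(complex^'n^'n) set" where
  "su = {X. conj_transpose X = - X \<and> trace X = 0}"

definition commutator :: "complex^'n^'n \<Rightarrow> complex^'n^'n \<Rightarrow> complex^'n^'n" where
  "commutator X Y = X ** Y - Y ** X"

text \<open>
  A triple of matrices is an element of \<^typ>\<open>complex^'n^'n^3\<close>, with entries \<open>T $ 1\<close>, \<open>T $ 2\<close>,
  \<open>T $ 3\<close>. In \<open>Nahm_solution I T\<close> the values of \<open>T\<close> outside the domain \<open>I\<close> are irrelevant; the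
  two-sided derivative is meant for open \<open>I\<close>.
\<close>

definition Nahm_solution :: "real set \<Rightarrow> (real \<Rightarrow> complex^'n^'n^3) \<Rightarrow> bool" where
  "Nahm_solution I T \<longleftrightarrow>
     (\<forall>t\<in>I. (\<forall>i. T t $ i \<in> su) \<and>
       ((\<lambda>s. T s $ 1) has_vector_derivative commutator (T t $ 2) (T t $ 3)) (at t) \<and>
       ((\<lambda>s. T s $ 2) has_vector_derivative commutator (T t $ 3) (T t $ 1)) (at t) \<and>
       ((\<lambda>s. T s $ 3) has_vector_derivative commutator (T t $ 1) (T t $ 2)) (at t))"

definition SO3 :: "(real^3^3) set" where
  "SO3 = {A. rotation_matrix A}"

definition rotate_triple :: "real^3^3 \<Rightarrow> complex^'n^'n^3 \<Rightarrow> complex^'n^'n^3" where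
  "rotate_triple A T = (\<chi> i. \<Sum>j\<in>UNIV. (A $ i $ j) *\<^sub>R (T $ j))"

definition conjugate_triple :: "complex^'n^'n \<Rightarrow> complex^'n^'n^3 \<Rightarrow> complex^'n^'n^3" where
  "conjugate_triple U T = (\<chi> i. U ** (T $ i) ** matrix_inv U)"

definition equivariance_witness ::
    "real set \<Rightarrow> (real \<Rightarrow> complex^'n^'n^3) \<Rightarrow> real^3^3 \<Rightarrow> complex^'n^'n \<Rightarrow> bool" where
  "equivariance_witness I T A U \<longleftrightarrow>
     U \<in> SU \<and> (\<forall>t\<in>I. rotate_triple A (T t) = conjugate_triple (matrix_inv U) (T t))"

definition equivariant ::
    "(real^3^3) set \<Rightarrow> real set \<Rightarrow> (real \<Rightarrow> complex^'n^'n^3) \<Rightarrow> bool" where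
  "equivariant H I T \<longleftrightarrow> (\<forall>A\<in>H. \<exists>U. equivariance_witness I T A U)"

text \<open>The axis is the line spanned by \<open>v\<close>, so this is meaningful only for \<open>v \<noteq> 0\<close>.\<close>

definition rotations_around :: "real^3 \<Rightarrow> (real^3^3) set" where
  "rotations_around v = {A \<in> SO3. A *v v = v}"

definition axially_symmetric :: "real set \<Rightarrow> (real \<Rightarrow> complex^'n^'n^3) \<Rightarrow> bool" where
  "axially_symmetric I T \<longleftrightarrow> (\<exists>v. v \<noteq> 0 \<and> equivariant (rotations_around v) I T)"

definition rot3 :: "real \<Rightarrow> real^3^3" where
  "rot3 \<theta> = vector [vector [cos \<theta>, - sin \<theta>, 0],
                   vector [sin \<theta>, cos \<theta>, 0],
                   vector [0, 0, 1]]"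

definition third_axis_rotations :: "(real^3^3) set" where
  "third_axis_rotations = rot3 ` {0..<2 * pi}"

definition axially_symmetric_third :: "real set \<Rightarrow> (real \<Rightarrow> complex^'n^'n^3) \<Rightarrow> bool" where
  "axially_symmetric_third I T \<longleftrightarrow> equivariant third_axis_rotations I T"

definition continuously_differentiable_at ::
    "(real \<Rightarrow> 'a::real_normed_vector) \<Rightarrow> real \<Rightarrow> bool" where
  "continuously_differentiable_at f x \<longleftrightarrow>
     (\<exists>f'. (\<forall>\<^sub>F y in nhds x. (f has_vector_derivative f' y) (at y)) \<and> isCont f' x)"

text \<open>
  Differentiability of \<open>A \<mapsto> U\<^sub>A\<close> at the identity refers to the subgroup of rotations around the
  third axis, parametrised by the angle; the identity is \<open>rot3 0\<close>. Only the values of \<open>U\<close> on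
  this subgroup matter.
\<close>

definition C1_at_identity :: "(real^3^3 \<Rightarrow> complex^'n^'n) \<Rightarrow> bool" where
  "C1_at_identity U \<longleftrightarrow> continuously_differentiable_at (\<lambda>\<theta>. U (rot3 \<theta>)) 0"

definition axial_equations ::
    "real set \<Rightarrow> (real \<Rightarrow> complex^'n^'n^3) \<Rightarrow> complex^'n^'n \<Rightarrow> bool" where
  "axial_equations I T Y \<longleftrightarrow>
     (\<forall>t\<in>I. T t $ 1 = commutator (T t $ 2) Y \<and>
            T t $ 2 = commutator Y (T t $ 1) \<and>
            0 = commutator Y (T t $ 3))"

text \<open>The explicit group of rotations around the third axis agrees with the general notion.\<close>

lemma rot3_nth:
  "rot3 \<theta> $ 1 $ 1 = cos \<theta>" "rot3 \<theta> $ 1 $ 2 = - sin \<theta>" "rot3 \<theta> $ 1 $ 3 = 0"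
  "rot3 \<theta> $ 2 $ 1 = sin \<theta>" "rot3 \<theta> $ 2 $ 2 = cos \<theta>" "rot3 \<theta> $ 2 $ 3 = 0"
  "rot3 \<theta> $ 3 $ 1 = 0" "rot3 \<theta> $ 3 $ 2 = 0" "rot3 \<theta> $ 3 $ 3 = 1"
  by (simp_all add: rot3_def)

lemma third_axis_rotations_eq: "third_axis_rotations = rotations_around (axis 3 1)"
proof (intro equalityI subsetI)
  fix A assume "A \<in> third_axis_rotations"
  then obtain \<theta> where A: "A = rot3 \<theta>" by (auto simp: third_axis_rotations_def)
  have s: "cos \<theta> * cos \<theta> + sin \<theta> * sin \<theta> = 1"
    using sin_cos_squared_add2[of \<theta>] by (simp add: power2_eq_square)
  show "A \<in> rotations_around (axis 3 1)"
    unfolding A rotations_around_def SO3_def rotation_matrix_def orthogonal_matrix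
    using s
    by (simp add: vec_eq_iff forall_3 matrix_matrix_mult_def matrix_vector_mult_def transpose_def
        sum_3 mat_def axis_def rot3_nth det_3 algebra_simps)
next
  fix A assume "A \<in> rotations_around (axis 3 1)"
  then have o: "transpose A ** A = mat 1" "A ** transpose A = mat 1"
    and d: "det A = 1" and f: "A *v axis 3 1 = axis 3 1"
    by (auto simp: rotations_around_def SO3_def rotation_matrix_def orthogonal_matrix_def)
  have c3: "A $ 1 $ 3 = 0" "A $ 2 $ 3 = 0" "A $ 3 $ 3 = 1"
    using f by (simp_all add: vec_eq_iff forall_3 matrix_vector_mult_def sum_3 axis_def)
  have "(A $ 3 $ 1)\<^sup>2 + (A $ 3 $ 2)\<^sup>2 = 0"
    using o(2) c3
    by (simp add: vec_eq_iff forall_3 matrix_matrix_mult_def transpose_def sum_3 mat_def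
        power2_eq_square)
  then have r3: "A $ 3 $ 1 = 0" "A $ 3 $ 2 = 0"
    by (simp_all add: sum_power2_eq_zero_iff)
  define a b c e where abce: "a = A $ 1 $ 1" "b = A $ 1 $ 2" "c = A $ 2 $ 1" "e = A $ 2 $ 2"
  have 1: "a * a + c * c = 1" "b * b + e * e = 1"
    using o(1) r3
    by (simp_all add: vec_eq_iff forall_3 matrix_matrix_mult_def transpose_def sum_3 mat_def abce)
  have 2: "a * e - b * c = 1"
    using d c3 r3 by (simp add: det_3 abce)
  have "(a - e)\<^sup>2 + (b + c)\<^sup>2 = 0"
    using 1 2 by (simp add: power2_eq_square algebra_simps)
  then have be: "e = a" "b = - c"
    by (simp_all add: sum_power2_eq_zero_iff)
  obtain \<theta> where \<theta>: "0 \<le> \<theta>" "\<theta> < 2 * pi" "a = cos \<theta>" "c = sin \<theta>"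
    using sincos_total_2pi[of a c] 1(1) by (auto simp: power2_eq_square)
  have "A = rot3 \<theta>"
    using c3 r3 be \<theta>(3,4) abce by (simp add: vec_eq_iff forall_3 rot3_nth)
  then show "A \<in> third_axis_rotations"
    using \<theta> by (auto simp: third_axis_rotations_def)
qed

end

theory Submission
  imports Defs
begin

text \<open>
  Differentiating \<open>U\<^sub>\<theta> (A(\<theta>)\<T>)\<^sub>i = T\<^sub>i U\<^sub>\<theta>\<close> at \<open>\<theta> = 0\<close> gives \<open>(*)\<close> with \<open>Y = U\<^sub>0\<^sup>-\<^sup>1 U'\<^sub>0\<close>, because
  \<open>U\<^sub>0\<close> commutes with every \<open>T\<^sub>i\<close>. This \<open>Y\<close> is skew-Hermitian, and subtracting a multiple of the
  identity makes it traceless without changing any commutator.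

  Conversely, if \<open>E(\<theta>) = exp(\<theta>Y)\<close> then \<open>(*)\<close> says exactly that \<open>E(\<theta>) (A(\<theta>)\<T>)\<^sub>i E(\<theta>)\<^sup>*\<close> has
  derivative zero in \<open>\<theta>\<close>, so that it equals \<open>T\<^sub>i\<close>; the unitary matrix \<open>E(\<theta>)\<close> is normalised to
  determinant one by a scalar. Conjugating by \<open>B\<close> moves the third axis to an arbitrary one.
\<close>

section \<open>Complex matrices\<close>

text \<open>In finite dimension bilinearity already gives boundedness. The interpretation that
  follows supplies the product rule for curves of matrices.\<close>

lemma bounded_bilinear_matrix_mult:
  "bounded_bilinear ((**) :: complex^'n^'n \<Rightarrow> complex^'n^'n \<Rightarrow> complex^'n^'n)"
  unfolding bilinear_conv_bounded_bilinear[symmetric] bilinear_def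
  by (intro conjI allI linearI)
    (simp_all add: vec_eq_iff matrix_matrix_mult_def algebra_simps sum.distrib scaleR_sum_right)

interpretation mat_mult: bounded_bilinear
  "(**) :: complex^'n^'n \<Rightarrow> complex^'n^'n \<Rightarrow> complex^'n^'n"
  by (rule bounded_bilinear_matrix_mult)

lemma bounded_linear_conj_transpose:
  "bounded_linear (conj_transpose :: complex^'n^'n \<Rightarrow> complex^'n^'n)"
  unfolding linear_conv_bounded_linear[symmetric]
  by (rule linearI) (simp_all add: vec_eq_iff conj_transpose_def)

lemma conj_transpose_mult: "conj_transpose (A ** B) = conj_transpose B ** conj_transpose A"
  by (simp add: vec_eq_iff conj_transpose_def matrix_matrix_mult_def mult.commute)

lemma conj_transpose_conj_transpose: "conj_transpose (conj_transpose A) = A"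
  by (simp add: vec_eq_iff conj_transpose_def)

lemma conj_transpose_mat: "conj_transpose (mat c) = mat (cnj c)"
  by (simp add: vec_eq_iff conj_transpose_def mat_def)

lemma mat_mult_commute: "mat c ** A = A ** mat c" for A :: "complex^'n^'n"
  by (simp add: vec_eq_iff matrix_matrix_mult_def mat_def mult_delta_left mult_delta_right)

lemma mat_mult_mat: "mat a ** mat b = (mat (a * b) :: complex^'n^'n)"
  by (simp add: vec_eq_iff matrix_matrix_mult_def mat_def mult_delta_left mult_delta_right)

lemma det_mat: "det (mat c :: complex^'n^'n) = c ^ CARD('n)"
  by (subst det_diagonal) (simp_all add: mat_def)

lemma det_conj_transpose: "det (conj_transpose A) = cnj (det A)" for A :: "complex^'n^'n"
proof -
  have "det (conj_transpose A) = cnj (det (transpose A))"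
    unfolding det_def by (simp add: conj_transpose_def transpose_def)
  then show ?thesis by (simp add: det_transpose)
qed

lemma matrix_inv_eqI:
  assumes "A ** B = mat 1" "B ** A = mat 1"
  shows "matrix_inv A = B"
proof -
  have "A ** matrix_inv A = mat 1"
    unfolding matrix_inv_def by (rule someI2[where a = B]) (use assms in auto)
  then have "B ** (A ** matrix_inv A) = B" by simp
  then show ?thesis by (simp add: matrix_mul_assoc assms)
qed

text \<open>For unitary \<open>U\<close> the inverse is the conjugate transpose. This trades the
  choice-based \<open>matrix_inv\<close> for a bounded real-linear map, through which derivatives
  can pass.\<close>

lemma equivariance_witness_iff:
  "equivariance_witness I T A U \<longleftrightarrow> U \<in> SU \<and>
     (\<forall>t\<in>I. \<forall>i. rotate_triple A (T t) $ i = conj_transpose U ** T t $ i ** U)"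
proof (cases "U \<in> SU")
  case True
  then have "conj_transpose U ** U = mat 1" "U ** conj_transpose U = mat 1"
    by (auto simp: SU_def)
  then have "matrix_inv U = conj_transpose U" "matrix_inv (conj_transpose U) = U"
    by (auto intro: matrix_inv_eqI)
  then show ?thesis
    by (simp add: equivariance_witness_def conjugate_triple_def vec_eq_iff[where 'b = 3] True)
qed (simp add: equivariance_witness_def)

text \<open>A scalar of modulus one cancels in a conjugation, so it is free to correct the
  determinant.\<close>

lemma unitary_scaled_into_SU:
  fixes U :: "complex^'n^'n"
  assumes "conj_transpose U ** U = mat 1"
  obtains V where "V \<in> SU" "\<And>X. conj_transpose V ** X ** V = conj_transpose U ** X ** U"
proof -
  let ?d = "det U" and ?n = "real CARD('n)"
  have "cnj ?d * ?d = 1"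
    using arg_cong[OF assms, of det] by (simp add: det_mul det_conj_transpose)
  then have "norm ?d = 1"
    by (metis complex_mod_sqrt_Re_mult_cnj mult.commute one_complex.sel(1) real_sqrt_one)
  then have d: "?d = cis (Arg ?d)"
    using rcis_cmod_Arg[of ?d] by (simp add: rcis_def)
  \<comment> \<open>An n-th root of the inverse of \<open>det U\<close>: scaling an n by n matrix by
    \<open>c\<close> multiplies its determinant by \<open>c ^ CARD('n)\<close>.\<close>
  define c where "c = cis (- Arg ?d / ?n)"
  have "c ^ CARD('n) = cis (- Arg ?d)"
    unfolding c_def Complex.DeMoivre by simp
  then have cd: "c ^ CARD('n) * ?d = 1"
    by (subst d) (simp add: cis_mult)
  have cc: "cnj c * c = 1"
    by (simp add: c_def cis_cnj cis_mult)
  define V where "V = mat c ** U"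
  have *: "conj_transpose V ** X ** V = conj_transpose U ** X ** U" for X
  proof -
    have "conj_transpose V ** X ** V = conj_transpose U ** (mat (cnj c) ** (X ** mat c)) ** U"
      by (simp add: V_def conj_transpose_mult conj_transpose_mat matrix_mul_assoc)
    also have "mat (cnj c) ** (X ** mat c) = mat (cnj c) ** mat c ** X"
      by (simp add: mat_mult_commute[of c X, symmetric] matrix_mul_assoc)
    also have "\<dots> = X"
      by (simp add: mat_mult_mat cc)
    finally show ?thesis .
  qed
  have 1: "conj_transpose V ** V = mat 1"
    using *[of "mat 1"] assms by simp
  moreover have "det V = 1"
    by (simp add: V_def det_mul det_mat cd)
  ultimately have "V \<in> SU"
    using matrix_left_right_inverse by (auto simp: SU_def)
  with * show thesis by (intro that)
qed

section \<open>Derivatives of matrix curves and the matrix exponential\<close>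

lemma has_vector_derivative_matrixI:
  fixes F :: "real \<Rightarrow> complex^'n^'m"
  assumes "\<And>i j. ((\<lambda>s. F s $ i $ j) has_vector_derivative D $ i $ j) (at x)"
  shows "(F has_vector_derivative D) (at x)"
  unfolding has_vector_derivative_def has_derivative_at_within
  using assms
  by (auto intro!: vec_tendstoI bounded_linear_scaleR_left
      simp: has_vector_derivative_def has_derivative_at_within)

text \<open>The function is \<open>\<theta> \<mapsto> exp(\<theta>Y)\<close>, differentiated entrywise as a power series.\<close>

lemma matrix_exponential_exists:
  fixes Y :: "complex^'n^'n"
  obtains E :: "real \<Rightarrow> complex^'n^'n" where
    "E 0 = mat 1" "\<forall>\<theta>. (E has_vector_derivative E \<theta> ** Y) (at \<theta>)"
proof -
  define P where "P k = ((\<lambda>M. M ** Y) ^^ k) (mat 1)" for k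
  have P0: "P 0 = mat 1" and PS: "P (Suc k) = P k ** Y" for k
    by (simp_all add: P_def)
  \<comment> \<open>\<open>P k\<close> is the k-th power of \<open>Y\<close>. Since \<open>K\<close>
    dominates every column sum of norms, induction bounds each entry of \<open>P k\<close> by
    \<open>K ^ k\<close>, and the scalar exponential series becomes a majorant.\<close>
  define K where "K = (\<Sum>i\<in>UNIV. \<Sum>j\<in>UNIV. norm (Y $ i $ j))"
  have K0: "K \<ge> 0" by (auto simp: K_def intro!: sum_nonneg)
  have col: "(\<Sum>l\<in>UNIV. norm (Y $ l $ j)) \<le> K" for j
    unfolding K_def by (rule sum_mono) (rule member_le_sum; simp)
  have bound: "norm (P k $ i $ j) \<le> K ^ k" for k i j
  proof (induction k arbitrary: i j)
    case 0
    show ?case by (simp add: P0 mat_def)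
  next
    case (Suc k)
    have "norm (P (Suc k) $ i $ j) \<le> (\<Sum>l\<in>UNIV. norm (P k $ i $ l) * norm (Y $ l $ j))"
      unfolding PS matrix_matrix_mult_def by (simp add: sum_norm_le norm_mult)
    also have "\<dots> \<le> (\<Sum>l\<in>UNIV. K ^ k * norm (Y $ l $ j))"
      by (intro sum_mono mult_right_mono Suc) auto
    also have "\<dots> \<le> K ^ k * K"
      using col[of j] K0 by (simp add: sum_distrib_left[symmetric] mult_left_mono)
    finally show ?case by (simp add: mult.commute)
  qed
  define c where "c i j k = P k $ i $ j / fact k" for i j k
  have summ: "summable (\<lambda>k. c i j k * z ^ k)" for i j and z :: complex
  proof (rule summable_comparison_test')
    show "summable (\<lambda>k. inverse (fact k) * (K * norm z) ^ k)"
      by (rule summable_exp)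
    show "norm (c i j k * z ^ k) \<le> inverse (fact k) * (K * norm z) ^ k" for k
      using bound[of k i j]
      by (simp add: c_def norm_mult norm_divide norm_power power_mult_distrib divide_simps
          mult_right_mono)
  qed
  \<comment> \<open>The factor \<open>k + 1\<close> from formal differentiation cancels against
    \<open>fact (k + 1)\<close>; what remains is the recursion
    \<open>P (Suc k) = P k ** Y\<close>.\<close>
  have diffs: "diffs (c i j) k = (\<Sum>l\<in>UNIV. c i l k * Y $ l $ j)" for i j k
  proof -
    have "diffs (c i j) k = P (Suc k) $ i $ j / fact k"
      by (simp add: diffs_def c_def del: of_nat_Suc)
    then show ?thesis
      by (simp add: PS matrix_matrix_mult_def c_def sum_divide_distrib)
  qed
  \<comment> \<open>The argument is complex to match the coefficients; the derivative is restricted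
    to the real line at the end.\<close>
  define e where "e i j z = (\<Sum>k. c i j k * z ^ k)" for i j and z :: complex
  have de: "(e i j has_field_derivative (\<Sum>l\<in>UNIV. e i l z * Y $ l $ j)) (at z)" for i j z
  proof -
    have "(e i j has_field_derivative (\<Sum>k. diffs (c i j) k * z ^ k)) (at z)"
      unfolding e_def by (rule termdiffs_strong_converges_everywhere[OF summ])
    also have "(\<Sum>k. diffs (c i j) k * z ^ k) = (\<Sum>k. \<Sum>l\<in>UNIV. c i l k * z ^ k * Y $ l $ j)"
      by (simp add: diffs sum_distrib_left mult_ac)
    also have "\<dots> = (\<Sum>l\<in>UNIV. \<Sum>k. c i l k * z ^ k * Y $ l $ j)"
      by (rule suminf_sum) (intro summable_mult2 summ)
    also have "\<dots> = (\<Sum>l\<in>UNIV. e i l z * Y $ l $ j)"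
      unfolding e_def by (intro sum.cong refl suminf_mult2[symmetric] summ)
    finally show ?thesis .
  qed
  define E where "E \<theta> = (\<chi> i j. e i j (of_real \<theta>))" for \<theta> :: real
  show thesis
  proof (rule that[of E])
    show "E 0 = mat 1"
      unfolding E_def e_def of_real_0 powser_zero by (simp add: vec_eq_iff c_def P0)
    show "\<forall>\<theta>. (E has_vector_derivative E \<theta> ** Y) (at \<theta>)"
      using has_vector_derivative_real_field[OF de]
      by (intro allI has_vector_derivative_matrixI) (simp add: E_def matrix_matrix_mult_def)
  qed
qed

section \<open>Rotations of triples\<close>

lemma rotate_triple_mult: "rotate_triple A (rotate_triple B T) = rotate_triple (A ** B) T"
proof -
  have "(\<Sum>j\<in>UNIV. \<Sum>k\<in>UNIV. (A $ i $ j * B $ j $ k) *\<^sub>R T $ k)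
      = (\<Sum>k\<in>UNIV. \<Sum>j\<in>UNIV. (A $ i $ j * B $ j $ k) *\<^sub>R T $ k)" for i
    by (rule sum.swap)
  then show ?thesis
    by (simp add: vec_eq_iff[where 'b = 3] rotate_triple_def matrix_matrix_mult_def
        scaleR_sum_right scaleR_sum_left)
qed

lemma rotate_triple_one: "rotate_triple (mat 1) T = T"
  unfolding rotate_triple_def mat_def
  by (simp add: vec_eq_iff[where 'b = 3] if_distrib if_distribR cong: if_cong)

text \<open>Rotations mix the components of a triple with real coefficients, whereas conjugation
  acts linearly inside each component, so the two actions commute.\<close>

lemma conj_transpose_mult_rotate_triple:
  "conj_transpose U ** rotate_triple A T $ i ** U =
     rotate_triple A (\<chi> j. conj_transpose U ** T $ j ** U) $ i"
  for U :: "complex^'n^'n"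
  by (simp add: rotate_triple_def mat_mult.sum_left mat_mult.sum_right
      mat_mult.scaleR_left mat_mult.scaleR_right)

lemma rotate_triple_rot3:
  "rotate_triple (rot3 \<theta>) T $ 1 = cos \<theta> *\<^sub>R T $ 1 - sin \<theta> *\<^sub>R T $ 2"
  "rotate_triple (rot3 \<theta>) T $ 2 = sin \<theta> *\<^sub>R T $ 1 + cos \<theta> *\<^sub>R T $ 2"
  "rotate_triple (rot3 \<theta>) T $ 3 = T $ 3"
  by (simp_all add: rotate_triple_def sum_3 rot3_nth)

text \<open>The action on triples of the generator of so(3) for the third axis, that is, the
  derivative at \<open>\<theta> = 0\<close> of the rotation by \<open>rot3 \<theta>\<close>.\<close>

definition rotation_generator :: "complex^'n^'n^3 \<Rightarrow> complex^'n^'n^3" where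
  "rotation_generator T = vector [- T $ 2, T $ 1, 0]"

lemma rotate_triple_rot3_has_vector_derivative:
  "((\<lambda>\<theta>. rotate_triple (rot3 \<theta>) T $ i) has_vector_derivative
     rotation_generator (rotate_triple (rot3 \<theta>) T) $ i) (at \<theta>)"
proof -
  have "\<forall>i. ((\<lambda>\<theta>. rotate_triple (rot3 \<theta>) T $ i) has_vector_derivative
     rotation_generator (rotate_triple (rot3 \<theta>) T) $ i) (at \<theta>)"
    unfolding forall_3 rotation_generator_def vector_3 rotate_triple_rot3
    by (auto intro!: derivative_eq_intros simp: has_real_derivative_iff_has_vector_derivative[symmetric])
  then show ?thesis by blast
qed

text \<open>In this form ad Y acts on the triple as minus the infinitesimal rotation, and all three
  components can be treated at once.\<close>

lemma axial_equations_iff: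
  "axial_equations I T Y \<longleftrightarrow>
     (\<forall>t\<in>I. \<forall>i. commutator Y (T t $ i) = - rotation_generator (T t) $ i)"
  unfolding axial_equations_def forall_3 rotation_generator_def vector_3 commutator_def
  by (auto simp: algebra_simps)

lemma rot3_0: "rot3 0 = mat 1"
  by (simp add: vec_eq_iff forall_3 rot3_nth mat_def)

text \<open>The group is given by angles from 0 to \<open>2 * pi\<close>, but a two-sided derivative
  at the identity needs negative angles too.\<close>

lemma rot3_in_third_axis_rotations: "rot3 \<theta> \<in> third_axis_rotations"
proof -
  obtain \<phi> where "0 \<le> \<phi>" "\<phi> < 2 * pi" "cos \<theta> = cos \<phi>" "sin \<theta> = sin \<phi>"
    using sincos_total_2pi[of "cos \<theta>" "sin \<theta>"] by auto
  then show ?thesis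
    unfolding third_axis_rotations_def rot3_def by (intro image_eqI[of _ _ \<phi>]) auto
qed

section \<open>Axial symmetry\<close>

lemma axial_equations_of_equivariance:
  fixes T :: "real \<Rightarrow> complex^'n^'n^3"
  assumes U: "\<And>A. A \<in> third_axis_rotations \<Longrightarrow> equivariance_witness I T A (U A)"
    and diff: "C1_at_identity U"
  obtains Y where "Y \<in> su" "axial_equations I T Y"
proof -
  define u where "u \<theta> = U (rot3 \<theta>)" for \<theta>
  have SU: "conj_transpose (u \<theta>) ** u \<theta> = mat 1" "u \<theta> ** conj_transpose (u \<theta>) = mat 1"
    and eq: "t \<in> I \<Longrightarrow> rotate_triple (rot3 \<theta>) (T t) $ i = conj_transpose (u \<theta>) ** T t $ i ** u \<theta>"
    for \<theta> t i
    using U[OF rot3_in_third_axis_rotations, of \<theta>]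
    by (auto simp: equivariance_witness_iff SU_def u_def)
  obtain u' where u': "(u has_vector_derivative u') (at 0)"
    using eventually_nhds_x_imp_x diff
    unfolding C1_at_identity_def continuously_differentiable_at_def u_def by blast
  \<comment> \<open>The witness \<open>u 0\<close> at the identity may differ from
    \<open>mat 1\<close>. The curve \<open>v\<close> is normalised to pass through
    \<open>mat 1\<close>, and \<open>Z\<close> is its velocity there.\<close>
  define Z where "Z = conj_transpose (u 0) ** u'"
  define v where "v \<theta> = conj_transpose (u 0) ** u \<theta>" for \<theta>
  have v0: "v 0 = mat 1" by (simp add: v_def SU)
  have v': "(v has_vector_derivative Z) (at 0)"
    unfolding v_def Z_def by (intro bounded_linear.has_vector_derivative[OF _ u'] mat_mult.bounded_linear_right)
  have vv: "conj_transpose (v \<theta>) ** v \<theta> = mat 1" for \<theta>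
  proof -
    have "conj_transpose (v \<theta>) ** v \<theta>
        = conj_transpose (u \<theta>) ** (u 0 ** conj_transpose (u 0)) ** u \<theta>"
      by (simp add: v_def conj_transpose_mult matrix_mul_assoc conj_transpose_conj_transpose)
    then show ?thesis by (simp add: SU)
  qed
  \<comment> \<open>Differentiating the unitarity relation, whose left side is constant, shows that
    \<open>Z\<close> is skew-Hermitian.\<close>
  have "((\<lambda>\<theta>. conj_transpose (v \<theta>) ** v \<theta>) has_vector_derivative
      conj_transpose (v 0) ** Z + conj_transpose Z ** v 0) (at 0)"
    by (intro mat_mult.has_vector_derivative v'
        bounded_linear.has_vector_derivative[OF bounded_linear_conj_transpose v'])
  then have "Z + conj_transpose Z = 0"
    unfolding vv v0
    by (simp add: conj_transpose_mat has_vector_derivative_const vector_derivative_unique_at)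
  then have skew: "conj_transpose Z = - Z"
    by (simp add: add_eq_0_iff)
  have comm: "commutator Z (T t $ i) = - rotation_generator (T t) $ i" if t: "t \<in> I" for t i
  proof -
    let ?R = "\<lambda>\<theta>. rotate_triple (rot3 \<theta>) (T t) $ i"
    \<comment> \<open>At angle zero the rotation is trivial, so \<open>u 0\<close> commutes with
      each component; hence \<open>v\<close> intertwines the rotated and original triples just as
      \<open>u\<close> does.\<close>
    have "T t $ i = conj_transpose (u 0) ** T t $ i ** u 0"
      using eq[OF t, of 0 i] by (simp add: rot3_0 rotate_triple_one)
    then have com0: "conj_transpose (u 0) ** T t $ i = T t $ i ** conj_transpose (u 0)"
      by (metis SU(2) matrix_mul_assoc matrix_mul_rid)
    have vR: "v \<theta> ** ?R \<theta> = T t $ i ** v \<theta>" for \<theta>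
    proof -
      have "v \<theta> ** ?R \<theta>
          = conj_transpose (u 0) ** (u \<theta> ** conj_transpose (u \<theta>)) ** T t $ i ** u \<theta>"
        unfolding eq[OF t] v_def by (simp add: matrix_mul_assoc)
      also have "\<dots> = T t $ i ** v \<theta>"
        by (simp add: SU com0 v_def matrix_mul_assoc)
      finally show ?thesis .
    qed
    have R0: "?R 0 = T t $ i" by (simp add: rot3_0 rotate_triple_one)
    \<comment> \<open>The two sides of the intertwining relation \<open>vR\<close> are
      differentiated separately; uniqueness of the derivative yields the commutator
      identity.\<close>
    have "((\<lambda>\<theta>. v \<theta> ** ?R \<theta>) has_vector_derivative
        v 0 ** rotation_generator (rotate_triple (rot3 0) (T t)) $ i + Z ** ?R 0) (at 0)"
      by (intro mat_mult.has_vector_derivative v' rotate_triple_rot3_has_vector_derivative)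
    moreover have "((\<lambda>\<theta>. v \<theta> ** ?R \<theta>) has_vector_derivative T t $ i ** Z) (at 0)"
      unfolding vR by (intro bounded_linear.has_vector_derivative[OF _ v'] mat_mult.bounded_linear_right)
    ultimately have "rotation_generator (T t) $ i + Z ** T t $ i = T t $ i ** Z"
      unfolding v0 R0
      by (auto dest: vector_derivative_unique_at simp: rot3_0 rotate_triple_one)
    then show ?thesis
      by (simp add: commutator_def algebra_simps)
  qed
  \<comment> \<open>The mean of the diagonal of \<open>Z\<close>. It is purely imaginary because
    \<open>Z\<close> is skew-Hermitian, so subtracting \<open>mat z\<close> removes the trace and
    keeps skewness.\<close>
  define z where "z = trace Z / of_nat CARD('n)"
  define Y where "Y = Z - mat z"
  have "cnj (trace Z) = trace (conj_transpose Z)"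
    by (simp add: trace_def conj_transpose_def)
  also have "\<dots> = - trace Z"
    unfolding skew by (simp add: trace_def sum_negf)
  finally have "cnj z = - z"
    by (simp add: z_def)
  then have "conj_transpose Y = - Y"
    using skew by (auto simp: Y_def conj_transpose_def vec_eq_iff mat_def)
  moreover have "trace Y = 0"
    by (simp add: Y_def z_def trace_def mat_def sum_subtractf)
  moreover have "commutator Y X = commutator Z X" for X
    by (simp add: Y_def commutator_def mat_mult.diff_left mat_mult.diff_right mat_mult_commute)
  ultimately show thesis
    using that[of Y] comm by (simp add: su_def axial_equations_iff)
qed

section \<open>From the axial equations to symmetry around the third axis\<close>

lemma axially_symmetric_third_of_axial_equations:
  fixes T :: "real \<Rightarrow> complex^'n^'n^3"
  assumes Y: "Y \<in> su" and ax: "axial_equations I T Y"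
  shows "axially_symmetric_third I T"
proof -
  have skew: "conj_transpose Y = - Y" using Y by (simp add: su_def)
  obtain E :: "real \<Rightarrow> complex^'n^'n" where E0: "E 0 = mat 1"
    and "\<forall>\<theta>. (E has_vector_derivative E \<theta> ** Y) (at \<theta>)"
    by (rule matrix_exponential_exists)
  then have E': "(E has_vector_derivative E \<theta> ** Y) (at \<theta>)" for \<theta>
    by blast
  let ?E = "\<lambda>\<theta>. conj_transpose (E \<theta>)"
  have cE': "(?E has_vector_derivative - (Y ** ?E \<theta>)) (at \<theta>)" for \<theta>
    using bounded_linear.has_vector_derivative[OF bounded_linear_conj_transpose E'[of \<theta>]]
    by (simp add: conj_transpose_mult skew mat_mult.minus_left)
  have const: "f \<theta> = f 0" if "\<And>\<theta>. (f has_vector_derivative 0) (at \<theta>)"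
    for f :: "real \<Rightarrow> complex^'n^'n" and \<theta>
    by (rule has_derivative_zero_unique[OF convex_UNIV])
      (use that in \<open>simp_all add: has_vector_derivative_def\<close>)
  \<comment> \<open>Unitarity: as \<open>Y\<close> is skew-Hermitian, the two terms of the product
    rule cancel.\<close>
  have "E \<theta> ** ?E \<theta> = E 0 ** ?E 0" for \<theta>
  proof (rule const)
    show "((\<lambda>\<theta>. E \<theta> ** ?E \<theta>) has_vector_derivative 0) (at \<theta>)" for \<theta>
      using mat_mult.has_vector_derivative[OF E'[of \<theta>] cE'[of \<theta>]]
      by (simp add: mat_mult.minus_right matrix_mul_assoc)
  qed
  then have "E \<theta> ** ?E \<theta> = mat 1" for \<theta>
    by (simp add: E0 conj_transpose_mat)
  then have unitary: "?E \<theta> ** E \<theta> = mat 1" for \<theta>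
    using matrix_left_right_inverse by blast
  have rot: "rotate_triple (rot3 \<theta>) (T t) $ i = ?E \<theta> ** T t $ i ** E \<theta>"
    if t: "t \<in> I" for t i \<theta>
  proof -
    let ?W = "\<lambda>\<theta>. rotate_triple (rot3 \<theta>) (T t)"
    have c: "commutator Y (T t $ 1) = T t $ 2" "commutator Y (T t $ 2) = - T t $ 1"
      "commutator Y (T t $ 3) = 0"
      using ax t unfolding axial_equations_iff rotation_generator_def by (auto simp: forall_3)
    have lin: "commutator Y (a *\<^sub>R X + b *\<^sub>R X') = a *\<^sub>R commutator Y X + b *\<^sub>R commutator Y X'"
      for a b X X'
      by (simp add: commutator_def mat_mult.add_left mat_mult.add_right
          mat_mult.scaleR_left mat_mult.scaleR_right algebra_simps)
    \<comment> \<open>The axial equations are linear in the triple and invariant under rotations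
      around the third axis, so they pass from \<open>T t\<close> to every
      \<open>?W \<theta>\<close>.\<close>
    have "\<forall>i. commutator Y (?W \<theta> $ i) = - rotation_generator (?W \<theta>) $ i" for \<theta>
      using lin[of "cos \<theta>" "T t $ 1" "- sin \<theta>" "T t $ 2"]
        lin[of "sin \<theta>" "T t $ 1" "cos \<theta>" "T t $ 2"]
      unfolding forall_3 rotation_generator_def vector_3 rotate_triple_rot3 c by (simp add: c)
    then have gen: "rotation_generator (?W \<theta>) $ i = ?W \<theta> $ i ** Y - Y ** ?W \<theta> $ i" for \<theta>
      by (metis commutator_def minus_diff_eq minus_minus)
    \<comment> \<open>By \<open>gen\<close> the rotated component \<open>W\<close> has derivative
      \<open>W Y - Y W\<close>. In the product rule this cancels the terms from \<open>E\<close> and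
      its conjugate transpose, so the product is constant.\<close>
    have "E \<theta> ** ?W \<theta> $ i ** ?E \<theta> = E 0 ** ?W 0 $ i ** ?E 0" for \<theta>
    proof (rule const)
      show "((\<lambda>\<theta>. E \<theta> ** ?W \<theta> $ i ** ?E \<theta>) has_vector_derivative 0) (at \<theta>)" for \<theta>
        using mat_mult.has_vector_derivative[OF mat_mult.has_vector_derivative[OF E'[of \<theta>]
              rotate_triple_rot3_has_vector_derivative[of "T t" i \<theta>]] cE'[of \<theta>]]
        by (simp add: gen mat_mult.minus_right mat_mult.add_left mat_mult.diff_left
            mat_mult.diff_right matrix_mul_assoc)
    qed
    then have "E \<theta> ** ?W \<theta> $ i ** ?E \<theta> = T t $ i"
      by (simp add: E0 rot3_0 rotate_triple_one conj_transpose_mat)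
    then have "?E \<theta> ** T t $ i ** E \<theta> = ?E \<theta> ** (E \<theta> ** ?W \<theta> $ i ** ?E \<theta>) ** E \<theta>"
      by simp
    also have "\<dots> = (?E \<theta> ** E \<theta>) ** ?W \<theta> $ i ** (?E \<theta> ** E \<theta>)"
      by (simp only: matrix_mul_assoc)
    finally show ?thesis by (simp add: unitary)
  qed
  show ?thesis
    unfolding axially_symmetric_third_def equivariant_def
  proof
    fix A assume "A \<in> third_axis_rotations"
    then obtain \<theta> where A: "A = rot3 \<theta>" by (auto simp: third_axis_rotations_def)
    obtain V where "V \<in> SU" "\<And>X. conj_transpose V ** X ** V = ?E \<theta> ** X ** E \<theta>"
      using unitary_scaled_into_SU[OF unitary[of \<theta>]] by blast
    then have "equivariance_witness I T A V"
      by (simp add: equivariance_witness_iff A rot)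
    then show "\<exists>U. equivariance_witness I T A U" ..
  qed
qed

section \<open>Symmetry around an arbitrary axis\<close>

lemma axially_symmetric_of_rotated:
  assumes B: "B \<in> SO3" and sym: "axially_symmetric_third I (\<lambda>t. rotate_triple B (T t))"
  shows "axially_symmetric I T"
proof -
  let ?B = "transpose B"
  have BB: "?B ** B = mat 1" "B ** ?B = mat 1" and dB: "det B = 1"
    using B by (auto simp: SO3_def rotation_matrix_def orthogonal_matrix_def)
  \<comment> \<open>The axis for \<open>T\<close> is the preimage of the third axis under
    \<open>B\<close>: if \<open>A\<close> fixes \<open>v\<close>, then \<open>B ** A ** ?B\<close>
    fixes \<open>axis 3 1\<close>.\<close>
  define v :: "real^3" where "v = ?B *v axis 3 1"
  have Bv: "B *v v = axis 3 1"
    unfolding v_def matrix_vector_mul_assoc BB by simp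
  then have "v \<noteq> 0"
    by (metis axis_eq_0_iff matrix_vector_mult_0_right zero_neq_one)
  moreover have "\<exists>U. equivariance_witness I T A U" if A: "A \<in> rotations_around v" for A
  proof -
    have "A \<in> SO3" "A *v v = v" using A by (auto simp: rotations_around_def)
    then have "orthogonal_matrix (B ** A ** ?B)" "det (B ** A ** ?B) = 1"
      using B by (auto simp: SO3_def rotation_matrix_def det_mul
          intro!: orthogonal_matrix_mul)
    moreover have "(B ** A ** ?B) *v axis 3 1 = axis 3 1"
      unfolding matrix_vector_mul_assoc[symmetric] v_def[symmetric] \<open>A *v v = v\<close> Bv ..
    ultimately have "B ** A ** ?B \<in> third_axis_rotations"
      by (simp add: third_axis_rotations_eq rotations_around_def SO3_def rotation_matrix_def)
    then obtain U where "U \<in> SU" and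
      U: "\<And>t i. t \<in> I \<Longrightarrow> rotate_triple (B ** A ** ?B) (rotate_triple B (T t)) $ i
        = conj_transpose U ** rotate_triple B (T t) $ i ** U"
      using sym by (auto simp: axially_symmetric_third_def equivariant_def equivariance_witness_iff)
    have "rotate_triple A (T t) = (\<chi> i. conj_transpose U ** T t $ i ** U)" if "t \<in> I" for t
    proof -
      \<comment> \<open>The same \<open>U\<close> serves for \<open>A\<close>: both sides of the
        witness equation become \<open>B\<close> applied to a triple, and \<open>B\<close> is then
        cancelled by \<open>?B\<close>.\<close>
      have "rotate_triple (B ** A ** ?B) (rotate_triple B (T t)) = rotate_triple B (rotate_triple A (T t))"
        by (simp add: rotate_triple_mult matrix_mul_assoc[symmetric] BB)
      then have "rotate_triple B (rotate_triple A (T t))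
          = rotate_triple B (\<chi> i. conj_transpose U ** T t $ i ** U)"
        using U[OF that] unfolding conj_transpose_mult_rotate_triple
        by (simp add: vec_eq_iff[where 'b = 3])
      then have "rotate_triple ?B (rotate_triple B (rotate_triple A (T t)))
          = rotate_triple ?B (rotate_triple B (\<chi> i. conj_transpose U ** T t $ i ** U))"
        by simp
      then show ?thesis
        unfolding rotate_triple_mult[of ?B B] BB rotate_triple_one .
    qed
    then have "equivariance_witness I T A U"
      using \<open>U \<in> SU\<close> by (simp add: equivariance_witness_iff)
    then show ?thesis ..
  qed
  ultimately show ?thesis
    unfolding axially_symmetric_def equivariant_def by blast
qed

theorem theorem3p1:
  fixes I :: "real set" and T :: "real \<Rightarrow> complex^'n^'n^3"
  assumes "open I" "connected I" "I \<noteq> {}"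
    and "Nahm_solution I T"
  shows "(axially_symmetric_third I T \<and>
          (\<exists>U. (\<forall>A\<in>third_axis_rotations. equivariance_witness I T A (U A)) \<and> C1_at_identity U)
            \<longrightarrow> (\<exists>Y\<in>su. axial_equations I T Y))
       \<and> ((\<exists>Y\<in>su. axial_equations I T Y) \<longrightarrow> axially_symmetric_third I T)
       \<and> ((\<exists>B\<in>SO3. \<exists>Y\<in>su. axial_equations I (\<lambda>t. rotate_triple B (T t)) Y)
            \<longrightarrow> axially_symmetric I T)"
proof (intro conjI impI)
  assume "axially_symmetric_third I T \<and>
    (\<exists>U. (\<forall>A\<in>third_axis_rotations. equivariance_witness I T A (U A)) \<and> C1_at_identity U)"
  then obtain U where "\<And>A. A \<in> third_axis_rotations \<Longrightarrow> equivariance_witness I T A (U A)"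
    and "C1_at_identity U"
    by blast
  then obtain Y where "Y \<in> su" "axial_equations I T Y"
    by (rule axial_equations_of_equivariance)
  then show "\<exists>Y\<in>su. axial_equations I T Y" ..
next
  assume "\<exists>Y\<in>su. axial_equations I T Y"
  then show "axially_symmetric_third I T"
    by (blast intro: axially_symmetric_third_of_axial_equations)
next
  assume "\<exists>B\<in>SO3. \<exists>Y\<in>su. axial_equations I (\<lambda>t. rotate_triple B (T t)) Y"
  then show "axially_symmetric I T"
    by (blast intro: axially_symmetric_of_rotated axially_symmetric_third_of_axial_equations)
qed

end
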